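(* Let $q$ be an odd prime power with $q \equiv 1 \pmod 4$, and let $A$ be an integer such that $q+1-A \equiv 0 \pmod 8$ (so that $q+1+A \equiv 4 \pmod 8$). Then $N_{n2}(A) = N_{n2}(-A) = N(-A)$.
   Context: For $d \in \mathbb{F}_q\setminus\{0,1\}$, $L_d$ denotes the Legendre elliptic curve $y^2 = x(x-1)(x-d)$ over $\mathbb{F}_q$, and $A(d,\mathbb{F}_q) = q+1-\#L_d(\mathbb{F}_q) = -\sum_{x\in\mathbb{F}_q}\chi_2(x(x-1)(x-d))$, where $\chi_2$ is the quadratic character of $\mathbb{F}_q$. For an integer $A$, $N(A)$ is the number of $d \in \mathbb{F}_q\setminus\{0,1\}$ with $A(d,\mathbb{F}_q)=A$, and $N_{n2}(A)$ is the number of such $d$ that are non-squares in $\mathbb{F}_q$. *)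

theory Defs
  imports "HOL-Number_Theory.Number_Theory" "HOL-Library.Cardinality"
begin

text \<open>
  A finite field with \<open>q\<close> elements is a type \<open>'a\<close> of sort \<open>{finite, field}\<close> with
  \<open>CARD('a) = q\<close>. The constant None stands for the point at infinity, which is the only
  point at infinity of the projective closure of \<open>y^2 = x(x-1)(x-d)\<close>.
\<close>

definition Legendre_curve :: "'a::{finite,field} \<Rightarrow> ('a \<times> 'a) option set" where
  "Legendre_curve d = insert None (Some ` {(x, y). y ^ 2 = x * (x - 1) * (x - d)})"

definition Legendre_trace :: "'a::{finite,field} \<Rightarrow> int" where
  "Legendre_trace d = int CARD('a) + 1 - int (card (Legendre_curve d))"

definition is_sq :: "'a::{finite,field} \<Rightarrow> bool" where
  "is_sq a \<longleftrightarrow> (\<exists>b. a = b ^ 2)"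

definition N_Legendre :: "'a::{finite,field} itself \<Rightarrow> int \<Rightarrow> nat" where
  "N_Legendre _ A = card {d::'a. d \<noteq> 0 \<and> d \<noteq> 1 \<and> Legendre_trace d = A}"

definition N_Legendre_n2 :: "'a::{finite,field} itself \<Rightarrow> int \<Rightarrow> nat" where
  "N_Legendre_n2 _ A =
     card {d::'a. d \<noteq> 0 \<and> d \<noteq> 1 \<and> Legendre_trace d = A \<and> \<not> is_sq d}"

definition quad_char :: "'a::{finite,field} \<Rightarrow> int" where
  "quad_char a = (if a = 0 then 0 else if is_sq a then 1 else -1)"

lemma card_square_roots:
  fixes a :: "'a::{finite,field}"
  assumes "(2::'a) \<noteq> 0"
  shows "int (card {y. y ^ 2 = a}) = 1 + quad_char a"
proof (cases "is_sq a")
  case True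
  then obtain b where b: "a = b ^ 2" by (auto simp: is_sq_def)
  have eq: "{y. y ^ 2 = a} = {b, -b}"
    unfolding b by (auto simp: power2_eq_iff)
  have neg: "b = -b \<longleftrightarrow> b = 0"
  proof
    assume "b = -b"
    then have "2 * b = 0" by (metis add.left_inverse mult_2)
    with assms show "b = 0" by simp
  qed simp
  then show ?thesis
    using True neg unfolding eq by (cases "b = 0") (simp_all add: quad_char_def b)
next
  case False
  then have "{y. y ^ 2 = a} = {}" and "a \<noteq> 0"
    by (auto simp: is_sq_def)
  with False show ?thesis by (simp add: quad_char_def)
qed

lemma Legendre_trace_char_sum:
  fixes d :: "'a::{finite,field}"
  assumes "(2::'a) \<noteq> 0"
  shows "Legendre_trace d = - (\<Sum>x\<in>UNIV. quad_char (x * (x - 1) * (x - d)))"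
proof -
  let ?f = "\<lambda>x::'a. x * (x - 1) * (x - d)"
  have set_eq: "{(x, y). y ^ 2 = ?f x} = (SIGMA x:UNIV. {y. y ^ 2 = ?f x})" by auto
  have "card (Legendre_curve d) = Suc (card {(x, y). y ^ 2 = ?f x})"
    unfolding Legendre_curve_def by (subst card_insert_disjoint) (auto simp: card_image)
  also have "\<dots> = Suc (\<Sum>x\<in>UNIV. card {y. y ^ 2 = ?f x})"
    unfolding set_eq by (subst card_SigmaI) auto
  finally have "int (card (Legendre_curve d)) = 1 + (\<Sum>x\<in>UNIV. int (card {y. y ^ 2 = ?f x}))"
    by simp
  also have "\<dots> = 1 + (\<Sum>x\<in>UNIV. 1 + quad_char (?f x))"
    by (simp only: card_square_roots[OF assms])
  also have "\<dots> = 1 + int CARD('a) + (\<Sum>x\<in>UNIV. quad_char (?f x))"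
    by (simp add: sum.distrib)
  finally show ?thesis by (simp add: Legendre_trace_def)
qed

end

theory Submission
  imports Defs
begin

text \<open>
  For a nonsquare \<open>d\<close>, the curve \<open>L_(1/d)\<close> is the quadratic twist of \<open>L_d\<close>, so \<open>d \<mapsto> 1/d\<close> swaps the
  nonsquare parameters of traces \<open>A\<close> and \<open>-A\<close>. For a square \<open>d\<close>, since \<open>-1\<close> is a square, \<open>(0,0)\<close> is
  divisible by 2 on \<open>L_d\<close>, so that \<open>8\<close> divides the order of the curve; as \<open>q + 1 + A\<close> is \<open>4\<close> modulo
  \<open>8\<close>, trace \<open>-A\<close> forces \<open>d\<close> to be a nonsquare. Instead of the group law, the divisibility by 8 is read
  off from the action of the 2-torsion on the \<open>x\<close>-coordinates, generated by \<open>x \<mapsto> d/x\<close> and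
  \<open>x \<mapsto> (x-d)/(x-1)\<close>.
\<close>

section \<open>Free Klein four-group actions and square roots of -1\<close>

text \<open>Commuting involutions generate an action of the Klein four-group; when no nontrivial
  element fixes a point, the orbits partition \<open>S\<close> into blocks of exactly four.\<close>

lemma four_dvd_card_if_free_involutions:
  assumes "finite S"
    and "\<And>x. x \<in> S \<Longrightarrow> s x \<in> S" and "\<And>x. x \<in> S \<Longrightarrow> t x \<in> S"
    and ss: "\<And>x. x \<in> S \<Longrightarrow> s (s x) = x" and tt: "\<And>x. x \<in> S \<Longrightarrow> t (t x) = x"
    and st: "\<And>x. x \<in> S \<Longrightarrow> s (t x) = t (s x)"
    and free: "\<And>x. x \<in> S \<Longrightarrow> s x \<noteq> x" "\<And>x. x \<in> S \<Longrightarrow> t x \<noteq> x" "\<And>x. x \<in> S \<Longrightarrow> s (t x) \<noteq> x"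
  shows "4 dvd card S"
proof -
  define orb where "orb x = {x, s x, t x, s (t x)}" for x
  have sub: "orb x \<subseteq> S" if "x \<in> S" for x
    using that assms(2,3) by (auto simp: orb_def)
  have orb_eq: "orb y = orb x" if "x \<in> S" "y \<in> orb x" for x y
  proof -
    have "y = x \<or> y = s x \<or> y = t x \<or> y = s (t x)"
      using that(2) by (simp add: orb_def)
    moreover have "orb (s z) = orb z" if "z \<in> S" for z
      using that ss st tt assms(2,3) unfolding orb_def by force
    moreover have "orb (t z) = orb z" if "z \<in> S" for z
      using that ss st tt assms(2,3) unfolding orb_def by force
    ultimately show ?thesis
      using that(1) assms(2,3) by metis
  qed
  have card4: "card (orb x) = 4" if x: "x \<in> S" for x
  proof -
    have "s x \<noteq> t x" using free(3)[OF x] ss[OF x] by metis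
    moreover have "s x \<noteq> s (t x)" using free(2)[OF x] ss[OF x] ss[OF assms(3)[OF x]] by metis
    moreover have "t x \<noteq> s (t x)" using free(1)[OF assms(3)[OF x]] by metis
    ultimately show ?thesis
      using free[OF x] by (simp add: orb_def)
  qed
  have "\<Union> (orb ` S) = S"
    using sub by (auto simp: orb_def)
  moreover have "4 dvd card (\<Union> (orb ` S))"
  proof (rule dvd_partition)
    show "finite (\<Union> (orb ` S))" using \<open>finite S\<close> sub by (meson UN_least finite_subset)
    show "\<forall>c\<in>orb ` S. 4 dvd card c" using card4 by auto
    show "\<forall>c1\<in>orb ` S. \<forall>c2\<in>orb ` S. c1 \<noteq> c2 \<longrightarrow> c1 \<inter> c2 = {}" using orb_eq by blast
  qed
  ultimately show ?thesis by simp
qed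

text \<open>Translation by 1 permutes the field, so summing all elements shows that
  \<open>CARD('a)\<close> vanishes in it; with 2 = 0 an odd cardinality would give 1 = 0.\<close>

lemma two_neq_0_if_odd_card:
  assumes "odd CARD('a::{finite,field})"
  shows "(2::'a) \<noteq> 0"
proof
  assume two: "(2::'a) = 0"
  have "(\<Sum>x\<in>(UNIV::'a set). x + 1) = (\<Sum>x\<in>UNIV. x)"
    by (rule sum.reindex_bij_witness[of _ "\<lambda>x. x - 1" "\<lambda>x. x + 1"]) auto
  then have "of_nat CARD('a) = (0::'a)"
    by (simp add: sum.distrib)
  moreover obtain k where "CARD('a) = 2 * k + 1"
    using assms by (rule oddE)
  ultimately show False
    using two by simp
qed

text \<open>Negation and inversion act on the field without 0, 1, -1. The fixed points of inversion
  are 1 and -1, those of the composite are the square roots of -1. Without such roots the action is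
  free and 4 divides q - 3, contrary to q = 1 modulo 4.\<close>

lemma minus_one_square_if_card:
  assumes "CARD('a::{finite,field}) mod 4 = 1" and two: "(2::'a) \<noteq> 0"
  shows "\<exists>i::'a. i ^ 2 = - 1"
proof (rule ccontr)
  assume no: "\<nexists>i::'a. i ^ 2 = - 1"
  have eq_minus: "- x = x \<longleftrightarrow> x = 0" for x :: 'a
  proof
    assume "- x = x"
    then have "2 * x = 0" by (metis add.left_inverse mult_2)
    with two show "x = 0" by simp
  qed simp
  let ?S = "UNIV - {0, 1, - 1 :: 'a}"
  have "4 dvd card ?S"
  proof (rule four_dvd_card_if_free_involutions[where s = uminus and t = inverse])
    fix x :: 'a assume x: "x \<in> ?S"
    show "- x \<in> ?S" using x by (auto simp: minus_equation_iff)
    show "inverse x \<in> ?S" using x inverse_eq_imp_eq[of x "- 1"] by auto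
    show "- x \<noteq> x" using x eq_minus by auto
    show "inverse x \<noteq> x"
    proof
      assume "inverse x = x"
      then have "x ^ 2 = 1" using x by (simp add: field_simps power2_eq_square)
      then show False using x by (simp add: power2_eq_1_iff)
    qed
    show "- inverse x \<noteq> x"
    proof
      assume "- inverse x = x"
      then have "x ^ 2 = - 1" using x by (metis DiffE insertCI left_inverse minus_equation_iff mult_minus_left power2_eq_square)
      then show False using no by blast
    qed
  qed auto
  moreover have "(1::'a) \<noteq> - 1" using eq_minus[of 1] by auto
  then have "card {0, 1, - 1 :: 'a} = 3" by simp
  then have "card ?S = CARD('a) - 3" and "CARD('a) \<ge> 3"
    using card_mono[of UNIV "{0, 1, - 1 :: 'a}"] by (simp_all add: card_Diff_subset)
  ultimately show False
    using assms(1) by presburger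
qed

section \<open>The quadratic character\<close>

lemma is_sq_mult_square_iff:
  assumes "c \<noteq> 0"
  shows "is_sq (c ^ 2 * w) \<longleftrightarrow> is_sq w"
proof
  assume "is_sq (c ^ 2 * w)"
  then obtain b where "c ^ 2 * w = b ^ 2" by (auto simp: is_sq_def)
  then have "w = (b / c) ^ 2" using assms by (simp add: field_simps)
  then show "is_sq w" by (auto simp: is_sq_def)
qed (auto simp: is_sq_def simp flip: power_mult_distrib)

lemma quad_char_mult_square: "c \<noteq> 0 \<Longrightarrow> quad_char (c ^ 2 * w) = quad_char w"
  by (simp add: quad_char_def is_sq_mult_square_iff)

lemma quad_char_square: "c \<noteq> 0 \<Longrightarrow> quad_char (c ^ 2) = 1"
  by (auto simp: quad_char_def is_sq_def)

text \<open>The fibres of squaring partition the field, and the fibre over \<open>a\<close> has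
  \<open>1 + quad_char a\<close> elements.\<close>

lemma sum_quad_char:
  assumes "(2::'a::{finite,field}) \<noteq> 0"
  shows "(\<Sum>a\<in>(UNIV::'a set). quad_char a) = 0"
proof -
  have "CARD('a) = card (\<Union>a\<in>(UNIV::'a set). {y. y ^ 2 = a})"
    by (rule arg_cong[where f = card]) auto
  also have "\<dots> = (\<Sum>a\<in>(UNIV::'a set). card {y. y ^ 2 = a})"
    by (rule card_UN_disjoint) auto
  finally have "int CARD('a) = (\<Sum>a\<in>(UNIV::'a set). int (card {y. y ^ 2 = a}))"
    by simp
  also have "\<dots> = int CARD('a) + (\<Sum>a\<in>(UNIV::'a set). quad_char a)"
    by (simp add: card_square_roots[OF assms] sum.distrib)
  finally show ?thesis by simp
qed

text \<open>Replaces the cyclicity of the unit group: \<open>quad_char x + quad_char (d * x)\<close>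
  is never positive, while its sum over the field is 0, so every term vanishes.\<close>

lemma quad_char_mult_nonsquare:
  fixes d :: "'a::{finite,field}"
  assumes two: "(2::'a) \<noteq> 0" and d: "\<not> is_sq d"
  shows "quad_char (d * w) = - quad_char w"
proof -
  have d0: "d \<noteq> 0" using d by (auto simp: is_sq_def)
  let ?g = "\<lambda>x. - (quad_char x + quad_char (d * x))"
  have nonneg: "?g x \<ge> 0" for x
  proof (cases "x = 0 \<or> \<not> is_sq x")
    case True
    then show ?thesis by (auto simp: quad_char_def)
  next
    case False
    then obtain b where b: "x = b ^ 2" "b \<noteq> 0" by (auto simp: is_sq_def)
    then have "quad_char (d * x) = quad_char d"
      by (metis quad_char_mult_square mult.commute)
    also have "\<dots> = - 1" using d d0 by (simp add: quad_char_def)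
    finally show ?thesis using b by (simp add: quad_char_square)
  qed
  have "(\<Sum>x\<in>UNIV. quad_char (d * x)) = (\<Sum>x\<in>(UNIV::'a set). quad_char x)"
    by (rule sum.reindex_bij_witness[of _ "\<lambda>x. x / d" "\<lambda>x. d * x"]) (use d0 in auto)
  then have "(\<Sum>x\<in>UNIV. ?g x) = 0"
    by (simp only: sum_negf sum.distrib sum_quad_char[OF two])
  then have "?g w = 0"
    by (rule sum_nonneg_0[OF finite nonneg _ UNIV_I])
  then show ?thesis by simp
qed

section \<open>Quadratic twisting\<close>

text \<open>Substituting \<open>d * x\<close> into the cubic for \<open>d\<close> yields d^3 times
  the cubic for 1/d, and d^3 has character -1.\<close>

lemma Legendre_trace_inverse:
  fixes d :: "'a::{finite,field}"
  assumes two: "(2::'a) \<noteq> 0" and d: "\<not> is_sq d"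
  shows "Legendre_trace (inverse d) = - Legendre_trace d"
proof -
  have d0: "d \<noteq> 0" using d by (auto simp: is_sq_def)
  let ?f = "\<lambda>d x::'a. x * (x - 1) * (x - d)"
  have "(\<Sum>x\<in>UNIV. quad_char (?f (inverse d) x)) = (\<Sum>x\<in>UNIV. - quad_char (?f d x))"
  proof (rule sum.reindex_bij_witness[of _ "\<lambda>x. x / d" "\<lambda>x. d * x"])
    fix x
    have "?f d (d * x) = d * (d ^ 2 * ?f (inverse d) x)"
      using d0 by (simp add: field_simps power2_eq_square)
    then show "- quad_char (?f d (d * x)) = quad_char (?f (inverse d) x)"
      by (simp only: quad_char_mult_nonsquare[OF two d] quad_char_mult_square[OF d0] minus_minus)
  qed (use d0 in auto)
  then show ?thesis
    by (simp add: Legendre_trace_char_sum[OF two] sum_negf)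
qed

section \<open>Divisibility of the curve order by 8\<close>

text \<open>The 4 counts infinity and the points with x = 0, 1, d; every other x on the curve
  carries two points.\<close>

lemma card_Legendre_curve:
  fixes d :: "'a::{finite,field}"
  assumes two: "(2::'a) \<noteq> 0" and "d \<noteq> 0" "d \<noteq> 1"
  shows "card (Legendre_curve d) = 4 + 2 * card {x. quad_char (x * (x - 1) * (x - d)) = 1}"
proof -
  let ?f = "\<lambda>x::'a. x * (x - 1) * (x - d)"
  let ?S = "{x. quad_char (?f x) = 1}"
  have "int (card (Legendre_curve d)) = 1 + (\<Sum>x\<in>UNIV. 1 + quad_char (?f x))"
    using Legendre_trace_char_sum[OF two, of d]
    by (simp add: Legendre_trace_def sum.distrib)
  also have "(\<Sum>x\<in>UNIV. 1 + quad_char (?f x)) =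
      (\<Sum>x\<in>UNIV. (if x \<in> {0, 1, d} then 1 else 0) + (if x \<in> ?S then 2 else 0))"
    by (rule sum.cong) (auto simp: quad_char_def)
  also have "\<dots> = int (card {0, 1, d}) + 2 * int (card ?S)"
    by (simp only: sum.distrib) (simp add: sum.If_cases del: insert_iff)
  also have "card {0, 1, d} = 3"
    using assms by auto
  finally show ?thesis by simp
qed

text \<open>It suffices that \<open>card S\<close> is 2 modulo 4. Outside the fixed points the
  2-torsion acts freely on \<open>S\<close>, so only the fixed points matter modulo 4.\<close>

lemma eight_dvd_card_Legendre_curve:
  fixes d :: "'a::{finite,field}"
  assumes two: "(2::'a) \<noteq> 0" and d: "d \<noteq> 0" "d \<noteq> 1"
    and e: "d = e ^ 2" and i: "i ^ 2 = (- 1 :: 'a)"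
  shows "8 dvd card (Legendre_curve d)"
proof -
  define f where "f x = x * (x - 1) * (x - d)" for x
  define S where "S = {x. quad_char (f x) = 1}"
  \<comment> \<open>\<open>s\<close> and \<open>t\<close> are translation by (0,0) and (1,0) on
    x-coordinates; their composite is translation by (d,0).\<close>
  define s where "s x = d / x" for x
  define t where "t x = (x - d) / (x - 1)" for x
  \<comment> \<open>The fixed-point equations of \<open>s\<close>, \<open>t\<close> and their
    composite, with the square completed so that solutions can be counted as square roots.\<close>
  define Fs where "Fs = {x. x ^ 2 = d}"
  define Ft where "Ft = {x. (x - 1) ^ 2 = 1 - d}"
  define Fst where "Fst = {x. (x - d) ^ 2 = d * (d - 1)}"
  have e0: "e \<noteq> 0" "e \<noteq> 1" "e \<noteq> - 1" and i0: "i \<noteq> 0"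
    using d e i by auto
  have S_neq: "x \<noteq> 0" "x \<noteq> 1" "x \<noteq> d" if "x \<in> S" for x
    using that by (auto simp: S_def f_def quad_char_def)
  have sq_in_S: "x \<in> S" if "f x = c ^ 2" "f x \<noteq> 0" for x c
    using that quad_char_square[of c] by (auto simp: S_def)
  have Ft_iff: "x \<in> Ft \<longleftrightarrow> x - d = x * (x - 1)" for x
  proof -
    have "(x - 1) ^ 2 - (1 - d) = x * (x - 1) - (x - d)"
      by (simp add: power2_eq_square algebra_simps)
    then show ?thesis unfolding Ft_def mem_Collect_eq by (metis right_minus_eq)
  qed
  have Fst_iff: "x \<in> Fst \<longleftrightarrow> x * (x - d) = d * (x - 1)" for x
  proof -
    have "(x - d) ^ 2 - d * (d - 1) = x * (x - d) - d * (x - 1)"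
      by (simp add: power2_eq_square algebra_simps)
    then show ?thesis unfolding Fst_def mem_Collect_eq by (metis right_minus_eq)
  qed

  have Fs_S: "Fs \<subseteq> S"
  proof
    fix x assume "x \<in> Fs"
    then have x: "d = x ^ 2" by (simp add: Fs_def)
    with d have x0: "x \<noteq> 0" "x \<noteq> 1" by auto
    \<comment> \<open>Here x - d = -x(x - 1), so the cubic is minus a square; this needs -1 to be a
      square.\<close>
    have "f x = i ^ 2 * (x * (x - 1)) ^ 2"
      unfolding f_def x i by (simp add: power2_eq_square algebra_simps)
    then show "x \<in> S"
      using x0 i0 by (intro sq_in_S[of _ "i * (x * (x - 1))"]) (simp_all add: power_mult_distrib)
  qed
  have Ft_S: "Ft \<subseteq> S"
  proof
    fix x assume "x \<in> Ft"
    then have x: "x - d = x * (x - 1)" by (simp add: Ft_iff)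
    have "x \<noteq> 0" "x \<noteq> 1" using x d by auto
    then show "x \<in> S"
      using x by (intro sq_in_S[of _ "x * (x - 1)"]) (simp_all add: f_def power2_eq_square)
  qed
  have Fst_S: "Fst \<subseteq> S"
  proof
    fix x assume "x \<in> Fst"
    then have x: "x * (x - d) = d * (x - 1)" by (simp add: Fst_iff)
    have "x \<noteq> 1" using x d by auto
    moreover have "f x = (x * (x - d)) * (x - 1)" by (simp add: f_def)
    \<comment> \<open>The cubic equals d(x - 1)^2, a square because d is one.\<close>
    then have "f x = (e * (x - 1)) ^ 2" unfolding x by (simp add: e power2_eq_square)
    ultimately show "x \<in> S"
      using e0 by (intro sq_in_S[of _ "e * (x - 1)"]) simp_all
  qed

  have disj: "Fs \<inter> Ft = {}" "Fs \<inter> Fst = {}" "Ft \<inter> Fst = {}"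
  proof -
    \<comment> \<open>In each of the three cases, subtracting the two equations leaves a product of
      factors that are nonzero on \<open>S\<close>.\<close>
    have False if "x \<in> Fs" "x \<in> Ft" for x
    proof -
      have "2 * (x - d) = (x ^ 2 - d) - ((x - 1) ^ 2 - (1 - d))"
        by (simp add: power2_eq_square algebra_simps)
      also have "\<dots> = 0" using that by (simp add: Fs_def Ft_def)
      finally have "2 * (x - d) = 0" .
      with two S_neq[of x] Fs_S that(1) show False by auto
    qed
    moreover have False if "x \<in> Fs" "x \<in> Fst" for x
    proof -
      have "2 * d * (x - 1) = (x ^ 2 - d) - ((x - d) ^ 2 - d * (d - 1))"
        by (simp add: power2_eq_square algebra_simps)
      also have "\<dots> = 0" using that by (simp add: Fs_def Fst_def)
      finally have "2 * d * (x - 1) = 0" .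
      with two d S_neq[of x] Fs_S that(1) show False by auto
    qed
    moreover have False if "x \<in> Ft" "x \<in> Fst" for x
    proof -
      have "2 * x * (d - 1) = ((x - 1) ^ 2 - (1 - d)) - ((x - d) ^ 2 - d * (d - 1))"
        by (simp add: power2_eq_square algebra_simps)
      also have "\<dots> = 0" using that by (simp add: Ft_def Fst_def)
      finally have "2 * x * (d - 1) = 0" .
      with two d S_neq[of x] Ft_S that(1) show False by auto
    qed
    ultimately show "Fs \<inter> Ft = {}" "Fs \<inter> Fst = {}" "Ft \<inter> Fst = {}" by auto
  qed

  have card_Fs: "card Fs = 2"
    using card_square_roots[OF two, of d] quad_char_square[OF e0(1)] by (simp add: Fs_def e)
  have card_Ft: "even (card Ft)"
  proof -
    have "card Ft = card {y. y ^ 2 = 1 - d}"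
      by (rule bij_betw_same_card[of "\<lambda>x. x - 1"])
        (rule bij_betwI[of _ _ _ "\<lambda>y. y + 1"], auto simp: Ft_def)
    moreover have "even (1 + quad_char (1 - d))"
      using d by (simp add: quad_char_def)
    ultimately show ?thesis
      using card_square_roots[OF two, of "1 - d"] by presburger
  qed
  \<comment> \<open>Since -d = (ie)^2, scaling by \<open>i * e\<close> carries the roots of 1 - d to
    those of d(d - 1). Whether 1 - d is a square stays open: the two sets together have 0 or 4
    elements.\<close>
  have card_Fst: "card Fst = card Ft"
  proof (rule bij_betw_same_card[of "\<lambda>x. (x - d) / (i * e) + 1"],
      rule bij_betwI[of _ _ _ "\<lambda>x. i * e * (x - 1) + d"])
    have ie: "(i * e) ^ 2 = - d" using i e by (simp add: power_mult_distrib)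
    show "(\<lambda>x. (x - d) / (i * e) + 1) \<in> Fst \<rightarrow> Ft"
    proof
      fix x assume "x \<in> Fst"
      then have "((x - d) / (i * e)) ^ 2 = d * (d - 1) / - d"
        unfolding power_divide ie by (simp add: Fst_def)
      also have "\<dots> = 1 - d" using d by simp
      finally show "(x - d) / (i * e) + 1 \<in> Ft" by (simp add: Ft_def)
    qed
    show "(\<lambda>x. i * e * (x - 1) + d) \<in> Ft \<rightarrow> Fst"
    proof
      fix x assume "x \<in> Ft"
      then have "(i * e * (x - 1)) ^ 2 = - d * (1 - d)"
        unfolding power_mult_distrib[of "i * e"] ie by (simp add: Ft_def)
      also have "\<dots> = d * (d - 1)" by (simp add: algebra_simps)
      finally show "i * e * (x - 1) + d \<in> Fst" by (simp add: Fst_def)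
    qed
  qed (use i0 e0 in auto)
  have card_fixed: "card (Fs \<union> Ft \<union> Fst) = 2 + 2 * card Ft"
    using disj by (subst card_Un_disjoint | simp add: card_Fs card_Fst Int_Un_distrib2)+

  have ss: "s (s x) = x" if "x \<in> S" for x
    using S_neq[OF that] d by (simp add: s_def)
  have tt: "t (t x) = x" if "x \<in> S" for x
  proof -
    have "t x - 1 = (1 - d) / (x - 1)" "t x - d = (1 - d) * x / (x - 1)"
      using S_neq[OF that] by (simp_all add: t_def field_simps)
    then show ?thesis using S_neq[OF that] d by (simp add: t_def[of "t x"])
  qed
  have st: "s (t x) = t (s x)" if "x \<in> S" for x
  proof -
    have "s x - d = d * (1 - x) / x" "s x - 1 = (d - x) / x"
      using S_neq[OF that] by (simp_all add: s_def field_simps)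
    then have "t (s x) = d * (1 - x) / (d - x)"
      using S_neq[OF that] by (simp add: t_def)
    also have "\<dots> = s (t x)"
      using S_neq[OF that] by (simp add: s_def t_def divide_simps) (simp add: algebra_simps)
    finally show ?thesis ..
  qed
  have s_S: "s x \<in> S" if "x \<in> S" for x
  proof -
    \<comment> \<open>Invariance of \<open>S\<close>: the cubic changes only by a nonzero square
      factor, and likewise under \<open>t\<close>.\<close>
    have "f (s x) = (d / x ^ 2) ^ 2 * f x"
      using S_neq[OF that] by (simp add: f_def s_def field_simps power2_eq_square)
    then show ?thesis
      using that d S_neq[OF that] by (simp add: S_def quad_char_mult_square del: power_divide)
  qed
  have t_S: "t x \<in> S" if "x \<in> S" for x
  proof -
    have "t x - 1 = (1 - d) / (x - 1)" "t x - d = (1 - d) * x / (x - 1)"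
      using S_neq[OF that] by (simp_all add: t_def field_simps)
    then have "f (t x) = ((1 - d) / (x - 1) ^ 2) ^ 2 * f x"
      using S_neq[OF that] by (simp add: f_def t_def[of x] divide_simps power2_eq_square)
    then show ?thesis
      using that d S_neq[OF that] by (simp add: S_def quad_char_mult_square del: power_divide)
  qed
  have s_fix: "s x = x \<longleftrightarrow> x \<in> Fs" if "x \<in> S" for x
    using S_neq[OF that] by (auto simp: s_def Fs_def field_simps power2_eq_square)
  have t_fix: "t x = x \<longleftrightarrow> x \<in> Ft" if "x \<in> S" for x
    using S_neq[OF that] by (simp add: t_def Ft_iff divide_eq_eq)
  have st_fix: "s (t x) = x \<longleftrightarrow> x \<in> Fst" if "x \<in> S" for x
    using S_neq[OF that] by (auto simp: s_def t_def Fst_iff divide_eq_eq)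

  let ?R = "S - (Fs \<union> Ft \<union> Fst)"
  \<comment> \<open>Described by trivial stabilisers, \<open>?R\<close> is visibly closed under the
    commuting maps \<open>s\<close> and \<open>t\<close>.\<close>
  have R_iff: "x \<in> ?R \<longleftrightarrow> x \<in> S \<and> s x \<noteq> x \<and> t x \<noteq> x \<and> s (t x) \<noteq> x" for x
    using s_fix t_fix st_fix by auto
  have "4 dvd card ?R"
  proof (rule four_dvd_card_if_free_involutions[where s = s and t = t])
    fix x assume x: "x \<in> ?R"
    then have xS: "x \<in> S" by simp
    show "s x \<in> ?R" "t x \<in> ?R"
      using x s_S[OF xS] t_S[OF xS] ss[OF xS] tt[OF xS] st[OF xS] ss[OF t_S[OF xS]] tt[OF s_S[OF xS]]
        st[OF s_S[OF xS]] st[OF t_S[OF xS]]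
      unfolding R_iff by metis+
  qed (use ss tt st R_iff in auto)
  moreover have "card S = card ?R + (2 + 2 * card Ft)"
    using card_fixed Fs_S Ft_S Fst_S
    by (metis (no_types, lifting) Un_least card_Diff_subset card_mono finite_class.finite_code
        finite le_add_diff_inverse2)
  ultimately have "4 dvd card S + 2"
    using card_Ft by presburger
  moreover have "card (Legendre_curve d) = 4 + 2 * card S"
    using card_Legendre_curve[OF two d] by (simp add: S_def f_def)
  ultimately show ?thesis by presburger
qed

theorem theorem6p6:
  fixes q :: nat and A :: int
  assumes "primepow q" and "odd q"
    and "CARD('a::{finite,field}) = q"
    and "[q = 1] (mod 4)"
    and "[int q + 1 - A = 0] (mod 8)"
  shows "N_Legendre_n2 TYPE('a) A = N_Legendre_n2 TYPE('a) (- A)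
       \<and> N_Legendre_n2 TYPE('a) (- A) = N_Legendre TYPE('a) (- A)"
proof
  have two: "(2::'a) \<noteq> 0"
    using assms(2,3) by (intro two_neq_0_if_odd_card) simp
  have q1: "q mod 4 = 1"
    using assms(4) by (simp add: cong_def)
  have inv: "is_sq (inverse d) \<longleftrightarrow> is_sq d" for d :: 'a
    unfolding is_sq_def by (metis inverse_inverse_eq power_inverse)
  show "N_Legendre_n2 TYPE('a) A = N_Legendre_n2 TYPE('a) (- A)"
    unfolding N_Legendre_n2_def
    by (rule bij_betw_same_card[of inverse], rule bij_betwI[of _ _ _ inverse])
      (auto simp: inv Legendre_trace_inverse[OF two])
  obtain i :: 'a where i: "i ^ 2 = - 1"
    using minus_one_square_if_card[OF _ two] q1 assms(3) by auto
  have "\<not> is_sq d" if d: "d \<noteq> 0" "d \<noteq> 1" "Legendre_trace d = - A" for d :: 'a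
  proof
    assume "is_sq d"
    then obtain e where e: "d = e ^ 2" by (auto simp: is_sq_def)
    have "int (card (Legendre_curve d)) = int q + 1 + A"
      using d(3) assms(3) by (simp add: Legendre_trace_def)
    moreover have "8 dvd int (card (Legendre_curve d))"
      using eight_dvd_card_Legendre_curve[OF two d(1,2) e i] by presburger
    moreover have "8 dvd int q + 1 - A"
      using assms(5) by (simp add: cong_0_iff)
    \<comment> \<open>The sum is 2q + 2, which is 4 modulo 8 because q is 1 modulo 4.\<close>
    ultimately have "8 dvd (int q + 1 + A) + (int q + 1 - A)"
      by (metis dvd_add)
    then show False using q1 by presburger
  qed
  then show "N_Legendre_n2 TYPE('a) (- A) = N_Legendre TYPE('a) (- A)"
    unfolding N_Legendre_n2_def N_Legendre_def by (metis (lifting))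
qed

end
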